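(* Let $X$ and $Y$ be Hausdorff topological spaces and let $\psi$ be a map assigning to each $x\in X$ a nonempty subset $\psi(x)\subset Y$, such that $$\psi^{-1}[U]\subset \psi^{\#}\left[\overline{U}\right]\quad\text{for every open } U\subset Y .$$ Then $\psi$ is singleton-valued, i.e. $\psi(x)$ is a one-point set for every $x\in X$ (so $\psi$ is a usual map from $X$ to $Y$).
   Context: For a set-valued mapping $\psi$ from $X$ to the nonempty subsets of $Y$ and $B\subset Y$, put $\psi^{-1}[B]=\{x\in X:\psi(x)\cap B\neq\varnothing\}$ and $\psi^{\#}[B]=\{x\in X:\psi(x)\subset B\}$. $\overline{U}$ denotes the closure of $U$ in $Y$. No continuity or compactness of $\psi$ is assumed. *)

theory Defs
  imports "HOL-Analysis.Analysis"
begin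

text \<open>
  Set-valued maps from a space \<open>X\<close> to a space \<open>Y\<close> are functions into \<open>'b set\<close>, of which only
  the values on the carrier \<open>topspace X\<close> matter. Hence both preimages are relative to a
  carrier \<open>S\<close>.
\<close>

definition lower_preimage :: "'a set \<Rightarrow> ('a \<Rightarrow> 'b set) \<Rightarrow> 'b set \<Rightarrow> 'a set"
  where "lower_preimage S \<psi> B = {x \<in> S. \<psi> x \<inter> B \<noteq> {}}"

definition upper_preimage :: "'a set \<Rightarrow> ('a \<Rightarrow> 'b set) \<Rightarrow> 'b set \<Rightarrow> 'a set"
  where "upper_preimage S \<psi> B = {x \<in> S. \<psi> x \<subseteq> B}"

end

theory Submission
  imports Defs
begin

text \<open>Suppose a value \<open>\<psi> x\<close> had two distinct points \<open>y\<close> and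
  \<open>z\<close>. Separate them by disjoint open sets \<open>U\<close> and \<open>V\<close>. Since
  \<open>\<psi> x\<close> meets \<open>U\<close> in \<open>y\<close>, the hypothesis forces all of
  \<open>\<psi> x\<close>, hence \<open>z\<close>, into the closure of \<open>U\<close>, which the
  neighbourhood \<open>V\<close> of \<open>z\<close> rules out.\<close>

theorem proposition2p1:
  fixes X :: "'a topology" and Y :: "'b topology" and \<psi> :: "'a \<Rightarrow> 'b set"
  assumes "Hausdorff_space X" and "Hausdorff_space Y"
    and "\<And>x. x \<in> topspace X \<Longrightarrow> \<psi> x \<noteq> {} \<and> \<psi> x \<subseteq> topspace Y"
    and "\<And>U. openin Y U \<Longrightarrow>
           lower_preimage (topspace X) \<psi> U \<subseteq> upper_preimage (topspace X) \<psi> (Y closure_of U)"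
  shows "\<forall>x \<in> topspace X. \<exists>y \<in> topspace Y. \<psi> x = {y}"
proof
  fix x assume x: "x \<in> topspace X"
  then obtain y where y: "y \<in> \<psi> x" "y \<in> topspace Y"
    using assms(3) by blast
  have "z = y" if z: "z \<in> \<psi> x" for z
  proof (rule ccontr)
    assume "z \<noteq> y"
    moreover have "z \<in> topspace Y"
      using assms(3) x z by blast
    ultimately obtain U V where UV: "openin Y U" "openin Y V" "y \<in> U" "z \<in> V" "disjnt U V"
      using assms(2) y(2) unfolding Hausdorff_space_def by metis
    have "x \<in> lower_preimage (topspace X) \<psi> U"
      using x y(1) UV(3) by (auto simp: lower_preimage_def)
    \<comment> \<open>Touching \<open>U\<close> at the single point \<open>y\<close> is enough to
      trap every other point of \<open>\<psi> x\<close> in the closure.\<close>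
    then have "z \<in> Y closure_of U"
      using assms(4)[OF UV(1)] z by (auto simp: upper_preimage_def)
    \<comment> \<open>\<open>V\<close> is an open neighbourhood of \<open>z\<close> that misses
      \<open>U\<close>.\<close>
    then show False
      using UV by (auto simp: in_closure_of disjnt_iff)
  qed
  then show "\<exists>y \<in> topspace Y. \<psi> x = {y}"
    using y by blast
qed

end
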